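(* Let $m\ge n\ge1$, $m\ge2$, be integers and let $p=(p_1,\dots,p_m)$ with $0<p_1\le\dots\le p_m<1$. With $\mathbb{E}_{PM}$ and $\mathbb{E}_{CM}$ as defined in the context, $$\mathbb{E}_{PM}\le\mathbb{E}_{CM}.$$
   Context: Put $\tilde p_i=p_i\prod_{j\ne i}(1-p_j)$. A Parseval frame in $\mathbb{R}^n$ with $m$ vectors is a sequence $(f_i)_{i=1}^m\subset\mathbb{R}^n$ with $\sum_i|\langle x,f_i\rangle|^2=\|x\|^2$ for all $x\in\mathbb{R}^n$. For a model $M$ with optimal Parseval frames $(f_i)_{i=1}^m$ set $\mathbb{E}_M=\frac{1}{\sum_{i=1}^m\tilde p_i}\sum_{i=1}^m\tilde p_i\|f_i\|^2$. For the model CM, the optimal Parseval frames are those with $\|f_i\|^2=\frac nm$ for all $i$, so that $\mathbb{E}_{CM}=\frac nm$. For the model PM, the optimal Parseval frames (assumed to exist for the given $p$) are those with $\|f_i\|^2=\frac{n}{m-1}\left(1-\frac{p_i}{\sum_{k=1}^m p_k}\right)$ for all $i$, so that $$\mathbb{E}_{PM}=\frac{n}{(m-1)\sum_{i=1}^m\tilde p_i}\sum_{i=1}^m\tilde p_i\left(1-\frac{p_i}{\sum_{k=1}^mp_k}\right).$$ *)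

theory Defs
  imports "HOL-Analysis.Analysis"
begin

text \<open>
  The space \<open>\<real>\<^sup>n\<close> is \<^typ>\<open>real ^ 'n\<close>, so \<open>n = CARD('n) \<ge> 1\<close>.  A sequence of \<open>m\<close> vectors is a function
  on \<^typ>\<open>nat\<close> of which only the values at the indices \<open>1, \<dots>, m\<close> matter; likewise for \<open>p\<close>.
\<close>

definition ptilde :: "nat \<Rightarrow> (nat \<Rightarrow> real) \<Rightarrow> nat \<Rightarrow> real" where
  "ptilde m p i = p i * (\<Prod>j\<in>{1..m} - {i}. 1 - p j)"

definition parseval_frame :: "nat \<Rightarrow> (nat \<Rightarrow> real ^ 'n) \<Rightarrow> bool" where
  "parseval_frame m f \<longleftrightarrow> (\<forall>x. (\<Sum>i = 1..m. \<bar>x \<bullet> f i\<bar>\<^sup>2) = (norm x)\<^sup>2)"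

definition frame_expectation :: "nat \<Rightarrow> (nat \<Rightarrow> real) \<Rightarrow> (nat \<Rightarrow> real ^ 'n) \<Rightarrow> real" where
  "frame_expectation m p f =
     1 / (\<Sum>i = 1..m. ptilde m p i) * (\<Sum>i = 1..m. ptilde m p i * (norm (f i))\<^sup>2)"

text \<open>
  A model is represented by its set \<open>F\<close> of optimal Parseval frames, and \<open>\<bbbE>\<^sub>M\<close> is computed from an
  arbitrary member of \<open>F\<close>.  For the two models below the value does not depend on the member
  (lemmas \<open>model_expectation_CM\<close> and \<open>model_expectation_PM\<close>).  The value is meaningless
  if \<open>F\<close> is empty; for CM this does not happen when \<open>m \<ge> n\<close>.
\<close>

definition model_expectation :: "nat \<Rightarrow> (nat \<Rightarrow> real) \<Rightarrow> (nat \<Rightarrow> real ^ 'n) set \<Rightarrow> real" where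
  "model_expectation m p F = frame_expectation m p (SOME f. f \<in> F)"

definition CM_optimal :: "nat \<Rightarrow> (nat \<Rightarrow> real ^ 'n) set" where
  "CM_optimal m =
     {f. parseval_frame m f \<and> (\<forall>i\<in>{1..m}. (norm (f i))\<^sup>2 = real CARD('n) / real m)}"

definition PM_optimal :: "nat \<Rightarrow> (nat \<Rightarrow> real) \<Rightarrow> (nat \<Rightarrow> real ^ 'n) set" where
  "PM_optimal m p =
     {f. parseval_frame m f \<and>
         (\<forall>i\<in>{1..m}. (norm (f i))\<^sup>2 =
            real CARD('n) / (real m - 1) * (1 - p i / (\<Sum>k = 1..m. p k)))}"

lemma sum_ptilde_pos:
  assumes "1 \<le> m" and "\<And>i. i \<in> {1..m} \<Longrightarrow> 0 < p i \<and> p i < 1"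
  shows "0 < (\<Sum>i = 1..m. ptilde m p i)"
  using assms by (intro sum_pos) (auto simp: ptilde_def intro!: mult_pos_pos prod_pos)

lemma model_expectation_CM:
  assumes "1 \<le> m" and "\<And>i. i \<in> {1..m} \<Longrightarrow> 0 < p i \<and> p i < 1"
    and "(CM_optimal m :: (nat \<Rightarrow> real ^ 'n) set) \<noteq> {}"
  shows "model_expectation m p (CM_optimal m :: (nat \<Rightarrow> real ^ 'n) set) = real CARD('n) / real m"
proof -
  define f :: "nat \<Rightarrow> real ^ 'n" where "f = (SOME f. f \<in> CM_optimal m)"
  have "f \<in> CM_optimal m"
    unfolding f_def using assms(3) by (simp add: some_in_eq)
  then have "(\<Sum>i = 1..m. ptilde m p i * (norm (f i))\<^sup>2) =
      (\<Sum>i = 1..m. ptilde m p i * (real CARD('n) / real m))"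
    by (intro sum.cong) (auto simp: CM_optimal_def)
  also have "\<dots> = (\<Sum>i = 1..m. ptilde m p i) * (real CARD('n) / real m)"
    by (rule sum_distrib_right [symmetric])
  finally have sum: "(\<Sum>i = 1..m. ptilde m p i * (norm (f i))\<^sup>2) =
      (\<Sum>i = 1..m. ptilde m p i) * (real CARD('n) / real m)" .
  have "0 < (\<Sum>i = 1..m. ptilde m p i)"
    using assms(1,2) by (rule sum_ptilde_pos)
  with sum show ?thesis
    by (simp add: model_expectation_def frame_expectation_def flip: f_def)
qed

lemma model_expectation_PM:
  assumes "(PM_optimal m p :: (nat \<Rightarrow> real ^ 'n) set) \<noteq> {}"
  shows "model_expectation m p (PM_optimal m p :: (nat \<Rightarrow> real ^ 'n) set) =
    real CARD('n) / ((real m - 1) * (\<Sum>i = 1..m. ptilde m p i)) *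
    (\<Sum>i = 1..m. ptilde m p i * (1 - p i / (\<Sum>k = 1..m. p k)))"
proof -
  define f :: "nat \<Rightarrow> real ^ 'n" where "f = (SOME f. f \<in> PM_optimal m p)"
  have "f \<in> PM_optimal m p"
    unfolding f_def using assms by (simp add: some_in_eq)
  then have "(\<Sum>i = 1..m. ptilde m p i * (norm (f i))\<^sup>2) =
      (\<Sum>i = 1..m. real CARD('n) / (real m - 1) *
         (ptilde m p i * (1 - p i / (\<Sum>k = 1..m. p k))))"
    by (intro sum.cong) (auto simp: PM_optimal_def mult.left_commute)
  also have "\<dots> = real CARD('n) / (real m - 1) *
      (\<Sum>i = 1..m. ptilde m p i * (1 - p i / (\<Sum>k = 1..m. p k)))"
    by (rule sum_distrib_left [symmetric])
  finally show ?thesis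
    by (simp add: model_expectation_def frame_expectation_def mult.commute flip: f_def)
qed

end

theory Submission
  imports Defs
begin

text \<open>
  The vectors of an optimal PM frame are the shorter the larger \<open>p i\<close> is, whereas the weight
  \<open>ptilde m p i = (p i / (1 - p i)) * (\<Prod>j. 1 - p j)\<close> grows with \<open>p i\<close>.  So the weighted mean of the
  squared lengths is at most their plain mean, by Chebyshev's sum inequality; and the plain mean is
  \<open>n / m\<close>, because the factors \<open>1 - p i / (\<Sum>k. p k)\<close> add up to \<open>m - 1\<close>.  This is lemma
  \<open>PM_mean_le\<close>.

  The number \<open>n / m\<close> is the value of the CM expectation only if an optimal CM frame exists, that is,
  a Parseval frame of \<open>m\<close> vectors of equal length in \<open>\<real>\<^sup>n\<close>, for every \<open>m \<ge> n\<close>.  One is given by the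
  coordinates \<open>(cos (\<omega> * \<theta>) + sin (\<omega> * \<theta>)) / sqrt m\<close>, where \<open>\<theta>\<close> runs through the \<open>m\<close> angles
  \<open>2 * pi * i / m\<close> and \<open>\<omega>\<close> through the \<open>n\<close> frequencies
  \<open>- (n - 1) / 2, - (n - 1) / 2 + 1, \<dots>, (n - 1) / 2\<close>.  The product of the coordinate functions of
  frequencies \<open>\<omega>\<close> and \<open>\<omega>'\<close> is \<open>(cos ((\<omega> - \<omega>') * \<theta>) + sin ((\<omega> + \<omega>') * \<theta>)) / m\<close>.  Both
  \<open>\<omega> - \<omega>'\<close> and \<open>\<omega> + \<omega>'\<close> are integers, and \<open>\<bar>\<omega> - \<omega>'\<bar> < n \<le> m\<close>, so summing over the angles gives
  \<open>1\<close> if \<open>\<omega> = \<omega>'\<close> and \<open>0\<close> otherwise, and the frame is Parseval.  With \<open>\<omega> = \<omega>'\<close> the sum over the frequencies is the squared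
  length of a vector, and there the sines cancel since the frequencies are symmetric about \<open>0\<close>.
  Half-integral frequencies for even \<open>n\<close> make this work also for \<open>n = m\<close>, where frequencies
  \<open>1, \<dots>, n / 2\<close> would include \<open>m / 2\<close>, whose sine vanishes at all the angles.
\<close>

section \<open>An equal-norm Parseval frame\<close>

lemma sum_cis_full_period:
  fixes m :: nat and k :: int
  assumes "1 \<le> m"
  shows "(\<Sum>i = 1..m. cis (of_int k * (2 * pi * real i / real m))) =
    (if int m dvd k then of_nat m else 0)"
proof -
  define z where "z = cis (2 * pi * of_int k / real m)"
  have power: "cis (of_int k * (2 * pi * real i / real m)) = z ^ i" for i
    unfolding z_def Complex.DeMoivre by (simp add: field_simps)
  have "z ^ m = cis (2 * pi * of_int k)"
    unfolding z_def Complex.DeMoivre using assms by (simp add: field_simps)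
  then have root: "z ^ m = 1"
    by (simp add: cis_multiple_2pi)
  have one_iff: "z = 1 \<longleftrightarrow> int m dvd k"
  proof
    assume "z = 1"
    then have "cos (2 * pi * of_int k / real m) = 1"
      unfolding z_def by (metis cis.sel(1) one_complex.sel(1))
    then obtain q :: int where "2 * pi * of_int k / real m = of_int q * 2 * pi"
      by (auto simp: cos_one_2pi_int)
    then have "real_of_int k = of_int q * real m"
      using assms by (simp add: field_simps)
    also have "\<dots> = of_int (q * int m)"
      by simp
    finally have "k = q * int m"
      by (simp only: of_int_eq_iff)
    then show "int m dvd k"
      by simp
  next
    assume "int m dvd k"
    then obtain q where "k = int m * q" ..
    then have "2 * pi * of_int k / real m = 2 * pi * of_int q"
      using assms by simp
    then have "z = cis (2 * pi * of_int q)"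
      unfolding z_def by (simp only:)
    then show "z = 1"
      by (simp only: cis_multiple_2pi Ints_of_int)
  qed
  show ?thesis
  proof (cases "z = 1")
    case True
    then show ?thesis
      by (simp only: power one_iff [symmetric]) simp
  next
    case False
    have "(\<Sum>i = 1..m. z ^ i) = z * (\<Sum>i<m. z ^ i)"
      by (simp add: sum.atLeast1_atMost_eq sum_distrib_left)
    also have "\<dots> = 0"
      using False by (simp add: geometric_sum root)
    finally show ?thesis
      using False by (simp only: power one_iff [symmetric]) simp
  qed
qed

lemma sum_cos_full_period:
  fixes m :: nat and k :: int
  assumes "1 \<le> m"
  shows "(\<Sum>i = 1..m. cos (of_int k * (2 * pi * real i / real m))) =
    (if int m dvd k then real m else 0)"
  using arg_cong [OF sum_cis_full_period [OF assms, of k], of Re]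
  by (simp del: times_divide_eq_right split: if_splits)

lemma sum_sin_full_period:
  fixes m :: nat and k :: int
  assumes "1 \<le> m"
  shows "(\<Sum>i = 1..m. sin (of_int k * (2 * pi * real i / real m))) = 0"
  using arg_cong [OF sum_cis_full_period [OF assms, of k], of Im]
  by (simp del: times_divide_eq_right split: if_splits)

definition centred_freq :: "nat \<Rightarrow> nat \<Rightarrow> real" where
  "centred_freq n a = real a - (real n - 1) / 2"

lemma sum_sin_centred_freq: "(\<Sum>a<n. sin (2 * centred_freq n a * t)) = 0"
proof -
  have "(\<Sum>a<n. sin (2 * centred_freq n a * t)) =
      (\<Sum>a<n. sin (2 * centred_freq n (n - Suc a) * t))"
    by (rule sum.nat_diff_reindex [symmetric])
  also have "\<dots> = (\<Sum>a<n. - sin (2 * centred_freq n a * t))"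
  proof (rule sum.cong [OF refl])
    fix a assume "a \<in> {..<n}"
    then have "centred_freq n (n - Suc a) = - centred_freq n a"
      by (simp add: centred_freq_def of_nat_diff field_simps)
    then show "sin (2 * centred_freq n (n - Suc a) * t) = - sin (2 * centred_freq n a * t)"
      by simp
  qed
  finally show ?thesis
    by (simp add: sum_negf)
qed

text \<open>The function \<open>cos + sin\<close> is the real kernel of the Hartley transform.\<close>

definition cas :: "real \<Rightarrow> real" where
  "cas t = cos t + sin t"

lemma cas_mult: "cas s * cas t = cos (s - t) + sin (s + t)"
  by (simp add: cas_def cos_diff sin_add algebra_simps)

lemma sum_cas_orthogonal:
  assumes "n \<le> m" "a < n" "b < n"
  shows "(\<Sum>i = 1..m. cas (centred_freq n a * (2 * pi * real i / real m)) *
           cas (centred_freq n b * (2 * pi * real i / real m))) = (if a = b then real m else 0)"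
proof -
  have m: "1 \<le> m"
    using assms by simp
  have diff: "centred_freq n a - centred_freq n b = of_int (int a - int b)"
    and add: "centred_freq n a + centred_freq n b = of_int (int a + int b - (int n - 1))"
    by (simp_all add: centred_freq_def field_simps)
  have "int m dvd int a - int b \<longleftrightarrow> a = b"
  proof
    assume "int m dvd int a - int b"
    moreover have "\<bar>int a - int b\<bar> < int m"
      using assms by linarith
    ultimately have "int a - int b = 0"
      using dvd_imp_le_int [of "int a - int b" "int m"] by linarith
    then show "a = b"
      by simp
  qed simp
  then show ?thesis
    unfolding cas_mult left_diff_distrib [symmetric] distrib_right [symmetric] diff add sum.distrib
      sum_cos_full_period [OF m] sum_sin_full_period [OF m]
    by simp
qed

lemma sum_cas_square: "(\<Sum>a<n. (cas (centred_freq n a * t))\<^sup>2) = real n"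
proof -
  have "(cas s)\<^sup>2 = 1 + sin (2 * s)" for s
    unfolding power2_eq_square cas_mult mult_2 by simp
  then have "(\<Sum>a<n. (cas (centred_freq n a * t))\<^sup>2) =
      (\<Sum>a<n. 1 + sin (2 * centred_freq n a * t))"
    by (simp only: mult.assoc)
  then show ?thesis
    by (simp only: sum.distrib sum_sin_centred_freq) simp
qed

text \<open>
  The Parseval identity holds as soon as the coordinate functions of the frame are orthonormal: the
  matrix with columns \<open>f i\<close> then has orthonormal rows.
\<close>

lemma parseval_frameI:
  fixes f :: "nat \<Rightarrow> real ^ 'n"
  assumes "\<And>a b. (\<Sum>i = 1..m. f i $ a * f i $ b) = (if a = b then 1 else 0)"
  shows "parseval_frame m f"
  unfolding parseval_frame_def
proof
  fix x :: "real ^ 'n"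
  have "(\<Sum>i = 1..m. \<bar>x \<bullet> f i\<bar>\<^sup>2) =
      (\<Sum>i = 1..m. \<Sum>a\<in>UNIV. \<Sum>b\<in>UNIV. x $ a * x $ b * (f i $ a * f i $ b))"
    by (simp add: inner_vec_def power2_eq_square sum_product mult_ac)
  also have "\<dots> = (\<Sum>a\<in>UNIV. \<Sum>i = 1..m. \<Sum>b\<in>UNIV. x $ a * x $ b * (f i $ a * f i $ b))"
    by (rule sum.swap)
  also have "\<dots> = (\<Sum>a\<in>UNIV. \<Sum>b\<in>UNIV. \<Sum>i = 1..m. x $ a * x $ b * (f i $ a * f i $ b))"
    by (intro sum.cong refl sum.swap)
  also have "\<dots> = (\<Sum>a\<in>UNIV. \<Sum>b\<in>UNIV. x $ a * x $ b * (if a = b then 1 else 0))"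
    by (simp only: sum_distrib_left [symmetric] assms)
  also have "\<dots> = x \<bullet> x"
    by (simp add: inner_vec_def if_distrib cong: if_cong)
  finally show "(\<Sum>i = 1..m. \<bar>x \<bullet> f i\<bar>\<^sup>2) = (norm x)\<^sup>2"
    by (simp add: power2_norm_eq_inner)
qed

lemma CM_optimal_nonempty:
  assumes "CARD('n::finite) \<le> m"
  shows "(CM_optimal m :: (nat \<Rightarrow> real ^ 'n) set) \<noteq> {}"
proof -
  let ?n = "CARD('n)"
  let ?g = "\<lambda>a i. cas (centred_freq ?n a * (2 * pi * real i / real m))"
  obtain h :: "'n \<Rightarrow> nat" where h: "bij_betw h UNIV {0..<?n}"
    using ex_bij_betw_finite_nat [OF finite] by blast
  have h_less: "h a < ?n" for a
    using bij_betwE [OF h] by simp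
  have h_eq: "h a = h b \<longleftrightarrow> a = b" for a b
    using bij_betw_imp_inj_on [OF h] by (simp add: inj_eq)
  have m: "0 < m"
    using assms by (rule less_le_trans [OF zero_less_card_finite])
  define f :: "nat \<Rightarrow> real ^ 'n" where "f i = (\<chi> a. ?g (h a) i / sqrt (real m))" for i
  have "(\<Sum>i = 1..m. f i $ a * f i $ b) = (\<Sum>i = 1..m. ?g (h a) i * ?g (h b) i) / real m" for a b
    using m by (simp add: f_def sum_divide_distrib)
  then have "(\<Sum>i = 1..m. f i $ a * f i $ b) = (if a = b then 1 else 0)" for a b
    using m by (simp only: sum_cas_orthogonal [OF assms h_less h_less] h_eq) simp
  then have "parseval_frame m f"
    by (rule parseval_frameI)
  moreover have "(norm (f i))\<^sup>2 = real ?n / real m" for i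
  proof -
    have "(norm (f i))\<^sup>2 = (\<Sum>a\<in>UNIV. (?g (h a) i)\<^sup>2) / real m"
      unfolding power2_norm_eq_inner inner_vec_def f_def
      by (simp add: sum_divide_distrib power_divide flip: power2_eq_square)
    also have "(\<Sum>a\<in>UNIV. (?g (h a) i)\<^sup>2) = (\<Sum>a<?n. (?g a i)\<^sup>2)"
      using sum.reindex_bij_betw [OF h, of "\<lambda>a. (?g a i)\<^sup>2"] by (simp add: atLeast0LessThan)
    finally show ?thesis
      by (simp only: sum_cas_square)
  qed
  ultimately have "f \<in> CM_optimal m"
    by (simp add: CM_optimal_def)
  then show ?thesis
    by blast
qed

section \<open>The weighted mean for PM\<close>

text \<open>
  The products defining the two weights differ in a single factor, so the claim reduces to
  \<open>p i * (1 - p j) \<le> p j * (1 - p i)\<close>.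
\<close>

lemma ptilde_mono:
  assumes "\<And>k. k \<in> {1..m} \<Longrightarrow> p k < 1" and "i \<in> {1..m}" "j \<in> {1..m}" and "p i \<le> p j"
  shows "ptilde m p i \<le> ptilde m p j"
proof (cases "i = j")
  case False
  let ?R = "\<Prod>k\<in>{1..m} - {i, j}. 1 - p k"
  have i: "{1..m} - {i} = insert j ({1..m} - {i, j})"
    and j: "{1..m} - {j} = insert i ({1..m} - {i, j})"
    using assms False by auto
  have "ptilde m p i = p i * (1 - p j) * ?R"
    unfolding ptilde_def i by (subst prod.insert) auto
  moreover have "ptilde m p j = p j * (1 - p i) * ?R"
    unfolding ptilde_def j by (subst prod.insert) auto
  moreover have "0 \<le> ?R"
    using assms(1) by (intro prod_nonneg) (auto intro: less_imp_le)
  moreover have "p i * (1 - p j) \<le> p j * (1 - p i)"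
    using assms(4) by (simp add: algebra_simps)
  ultimately show ?thesis
    by (simp only: mult_right_mono)
qed simp

lemma Chebyshev_sum_mono_on:
  fixes a b :: "nat \<Rightarrow> 'a::linordered_idom"
  assumes "mono_on {1..m} a" and "mono_on {1..m} b"
  shows "(\<Sum>i = 1..m. a i) * (\<Sum>i = 1..m. b i) \<le> of_nat m * (\<Sum>i = 1..m. a i * b i)"
proof -
  have "of_nat m * (\<Sum>k = 0..<m. a (Suc k) * - b (Suc k)) \<le>
      (\<Sum>k = 0..<m. a (Suc k)) * (\<Sum>k = 0..<m. - b (Suc k))"
    using assms by (intro Chebyshev_sum_upper) (auto simp: mono_on_def)
  then show ?thesis
    by (simp add: sum.atLeast1_atMost_eq atLeast0LessThan sum_negf)
qed

text \<open>
  Clearing denominators turns the claim into Chebyshev's inequality for the weights \<open>t\<close> and \<open>p\<close>.  The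
  dimension \<open>n\<close> occurs as a common factor of both expectations and is left out.
\<close>

lemma PM_mean_le:
  fixes p t :: "nat \<Rightarrow> real"
  assumes "2 \<le> m" and "mono_on {1..m} t" "mono_on {1..m} p"
    and T: "0 < (\<Sum>i = 1..m. t i)" and P: "0 < (\<Sum>k = 1..m. p k)"
  shows "1 / ((real m - 1) * (\<Sum>i = 1..m. t i)) *
    (\<Sum>i = 1..m. t i * (1 - p i / (\<Sum>k = 1..m. p k))) \<le> 1 / real m"
proof -
  let ?T = "\<Sum>i = 1..m. t i" and ?P = "\<Sum>k = 1..m. p k" and ?Q = "\<Sum>i = 1..m. t i * p i"
  have sum: "(\<Sum>i = 1..m. t i * (1 - p i / ?P)) = ?T - ?Q / ?P"
    by (simp add: right_diff_distrib sum_subtractf sum_divide_distrib)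
  have "?T * ?P \<le> real m * ?Q"
    by (rule Chebyshev_sum_mono_on [OF assms(2,3)])
  then have "?T \<le> real m * (?Q / ?P)"
    using P by (simp add: field_simps)
  then have "real m * (?T - ?Q / ?P) \<le> (real m - 1) * ?T"
    by (simp add: algebra_simps)
  then have "(?T - ?Q / ?P) / ((real m - 1) * ?T) \<le> 1 / real m"
    using T assms(1) by (simp add: divide_simps mult.commute)
  then show ?thesis
    unfolding sum by simp
qed

section \<open>Comparison of the two models\<close>

theorem proposition5p2:
  fixes m :: nat and p :: "nat \<Rightarrow> real"
  assumes "CARD('n::finite) \<le> m" and "2 \<le> m"
    and "0 < p 1" and "mono_on {1..m} p" and "p m < 1"
    and "(PM_optimal m p :: (nat \<Rightarrow> real ^ 'n) set) \<noteq> {}"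
  shows "model_expectation m p (PM_optimal m p :: (nat \<Rightarrow> real ^ 'n) set)
    \<le> model_expectation m p (CM_optimal m :: (nat \<Rightarrow> real ^ 'n) set)"
proof -
  have m: "1 \<le> m"
    using assms(2) by simp
  have p: "0 < p i \<and> p i < 1" if "i \<in> {1..m}" for i
    using that m assms(3,5) mono_onD [OF assms(4), of 1 i] mono_onD [OF assms(4), of i m] by auto
  let ?T = "\<Sum>i = 1..m. ptilde m p i"
  let ?S = "\<Sum>i = 1..m. ptilde m p i * (1 - p i / (\<Sum>k = 1..m. p k))"
  have "mono_on {1..m} (ptilde m p)"
    using p by (intro mono_onI ptilde_mono mono_onD [OF assms(4)]) auto
  moreover have "0 < ?T"
    using m p by (rule sum_ptilde_pos)
  moreover have "0 < (\<Sum>k = 1..m. p k)"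
    using m p by (intro sum_pos) auto
  ultimately have "1 / ((real m - 1) * ?T) * ?S \<le> 1 / real m"
    by (intro PM_mean_le assms(2,4))
  then have "real CARD('n) * (1 / ((real m - 1) * ?T) * ?S) \<le> real CARD('n) * (1 / real m)"
    by (rule mult_left_mono) simp
  moreover have "model_expectation m p (CM_optimal m :: (nat \<Rightarrow> real ^ 'n) set) =
      real CARD('n) / real m"
    using m p CM_optimal_nonempty [OF assms(1)] by (rule model_expectation_CM)
  ultimately show ?thesis
    unfolding model_expectation_PM [OF assms(6)] by simp
qed

end
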